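(* Let $X$ be any real-valued random variable with characteristic function $f(t)=\mathsf{E}e^{itX}$, and let $X_+:=\max(0,X)$. Then for every real $t$, $$\mathsf{E}\, e^{itX_+}=\tfrac12\,[1+f(t)]+(Jf)(t)-(Jf)(0).$$
   Context: For a characteristic function $f:\mathbb{R}\to\mathbb{C}$ and real $t$, $$(Jf)(t):=\frac1{2\pi i}\int_{-\infty}^\infty f(t+u)\,\frac{du}u:=\lim_{\varepsilon\downarrow0,\,A\uparrow\infty}\frac1{2\pi i}\left(\int_\varepsilon^A+\int_{-A}^{-\varepsilon}\right) f(t+u)\,\frac{du}u,$$ i.e. the integral is understood in the principal-value sense (at $0$ and at $\pm\infty$); this limit exists for every characteristic function $f$ and every real $t$. *)

theory Defs
  imports "HOL-Probability.Probability"
begin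

definition J_trunc :: "(real \<Rightarrow> complex) \<Rightarrow> real \<Rightarrow> real \<Rightarrow> real \<Rightarrow> complex" where
  "J_trunc f t \<epsilon> A = 1 / (2 * of_real pi * \<i>) *
     ((CLINT u:{\<epsilon>..A}|lborel. f (t + u) / of_real u) +
      (CLINT u:{-A..-\<epsilon>}|lborel. f (t + u) / of_real u))"

(* The limit is joint: no relation between the rates of \<epsilon> and A is imposed.
   Lim is a definite description, so J f t is meaningful only where J_trunc converges. *)
definition J :: "(real \<Rightarrow> complex) \<Rightarrow> real \<Rightarrow> complex" where
  "J f t = Lim (at_right 0 \<times>\<^sub>F at_top) (\<lambda>(\<epsilon>, A). J_trunc f t \<epsilon> A)"

definition J_converges :: "(real \<Rightarrow> complex) \<Rightarrow> real \<Rightarrow> bool" where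
  "J_converges f t \<longleftrightarrow>
     (\<exists>l. ((\<lambda>(\<epsilon>, A). J_trunc f t \<epsilon> A) \<longlongrightarrow> l) (at_right 0 \<times>\<^sub>F at_top))"

end

theory Submission
  imports Defs
begin

text \<open>
  Why the formula holds: \<open>J\<close> multiplies by half the sign on the side of the random variable, that is,
  \<open>J f t = E (exp (i t X) sgn X) / 2\<close>. Since \<open>sgn x = 1\<close>, \<open>0\<close> or \<open>-1\<close> according to the sign of \<open>x\<close>,
  the function \<open>(1 + exp (i t x)) / 2 + (exp (i t x) - 1) sgn x / 2\<close> equals \<open>exp (i t x)\<close> for
  \<open>x > 0\<close> and \<open>1\<close> for \<open>x \<le> 0\<close>, which is \<open>exp (i t max (0, x))\<close>; taking expectations gives the theorem.

  The formula for \<open>J\<close> comes from Fubini's theorem. Folding the negative half of the truncated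
  principal value onto the positive one turns \<open>f (t + u)\<close> into \<open>f (t + u) - f (t - u)\<close>, the
  expectation of \<open>2 i exp (i t X) sin (u X)\<close>. On \<open>[\<epsilon>, A]\<close> the factor \<open>1 / u\<close> is bounded, so the
  integrals may be exchanged, and integrating \<open>sin (u x) / u\<close> gives the sine integral:
  \<open>J_trunc f t \<epsilon> A = E (exp (i t X) (Si (A X) - Si (\<epsilon> X))) / \<pi>\<close> (lemma \<open>J_trunc_char\<close>).
  As \<open>Si\<close> is bounded, continuous with \<open>Si 0 = 0\<close>, and \<open>Si (A x)\<close> tends to \<open>sgn x \<pi> / 2\<close>, dominated
  convergence yields the limit (lemma \<open>J_trunc_char_tendsto\<close>). The two cut-offs occur in separate
  terms, so the joint limit exists whatever their relative rates.
\<close>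

section \<open>The sine integral\<close>

lemma LBINT_sin_scale_divide_Icc:
  fixes a b x :: real
  assumes "0 < a" "a \<le> b"
  shows "(LBINT u:{a..b}. sin (u * x) / u) = Si (b * x) - Si (a * x)"
proof -
  have "((\<lambda>u. Si (u * x)) has_real_derivative sin (u * x) / u) (at u)" if "a \<le> u" for u
  proof -
    have "((\<lambda>u. Si (u * x)) has_real_derivative sinc (u * x) * x) (at u)"
      by (rule DERIV_chain2[OF DERIV_Si]) (auto intro!: derivative_eq_intros)
    moreover have "sinc (u * x) * x = sin (u * x) / u"
      using that assms by (auto simp: field_simps)
    ultimately show ?thesis by simp
  qed
  moreover have "isCont (\<lambda>u. sin (u * x) / u) u" if "a \<le> u" for u
    using that assms by (intro continuous_intros) auto
  ultimately show ?thesis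
    using integral_FTC_Icc_real[of a b "\<lambda>u. Si (u * x)" "\<lambda>u. sin (u * x) / u"] assms
    by (simp add: set_lebesgue_integral_def mult.commute)
qed

lemma Si_zero: "Si 0 = 0"
  using Si_neg[of 0] by simp

lemma Si_minus: "Si (- y) = - Si y"
  using Si_neg[of y] Si_neg[of "- y"] by (cases "0 \<le> y") auto

text \<open>
  This limit is where the sign function comes from: the Dirichlet integral is odd in the frequency
  \<open>x\<close>, and scaling by \<open>x \<noteq> 0\<close> does not change its absolute value.
\<close>

lemma Si_scale_at_top: "((\<lambda>T. Si (T * x)) \<longlongrightarrow> pi / 2 * sgn x) at_top"
proof -
  have pos: "((\<lambda>T. Si (T * y)) \<longlongrightarrow> pi / 2) at_top" if "0 < y" for y
    by (rule filterlim_compose[OF Si_at_top])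
       (use that in \<open>auto intro: filterlim_at_top_mult_tendsto_pos[OF tendsto_const] filterlim_ident\<close>)
  consider "x = 0" | "x > 0" | "x < 0" by linarith
  then show ?thesis
  proof cases
    case 3
    then show ?thesis using tendsto_minus[OF pos[of "- x"]] by (simp add: Si_minus)
  qed (use pos Si_zero in auto)
qed

section \<open>The truncated principal value of a characteristic function\<close>

text \<open>
  The kernel \<open>1 / u\<close> is odd, so reflecting the integral over \<open>[-A, -\<epsilon>]\<close> leaves only the part of
  \<open>u \<mapsto> f (t + u)\<close> that is odd about \<open>t\<close>. This cancellation is what makes the principal value
  converge.
\<close>

lemma J_trunc_eq_odd_part:
  assumes "set_integrable lborel {e..A} (\<lambda>u. f (t + u) / of_real u)"
    and "set_integrable lborel {e..A} (\<lambda>u. f (t - u) / of_real u)"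
  shows "J_trunc f t e A = 1 / (2 * of_real pi * \<i>) *
    (CLINT u:{e..A}|lborel. (f (t + u) - f (t - u)) / of_real u)"
proof -
  have "{u. - u \<in> {-A..-e}} = {e..A}" by auto
  then have "(CLINT u:{-A..-e}|lborel. f (t + u) / of_real u) =
      (CLINT u:{e..A}|lborel. - (f (t - u) / of_real u))"
    by (subst set_integral_reflect) simp
  also have "\<dots> = - (CLINT u:{e..A}|lborel. f (t - u) / of_real u)"
    by (simp add: set_lebesgue_integral_def)
  finally show ?thesis
    using set_integral_diff(2)[OF assms] by (simp add: J_trunc_def diff_divide_distrib)
qed

lemma set_integrable_bounded_divide_Icc:
  fixes g :: "real \<Rightarrow> complex"
  assumes [measurable]: "g \<in> borel_measurable borel" and "\<And>u. norm (g u) \<le> B" and "0 < e"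
  shows "set_integrable lborel {e..A} (\<lambda>u. g u / of_real u)"
  unfolding set_integrable_def
proof (rule integrableI_bounded_set_indicator[where B = "B / e"])
  have "0 \<le> B" using assms(2)[of 0] norm_ge_zero order_trans by blast
  then show "AE u\<in>{e..A} in lborel. norm (g u / of_real u) \<le> B / e"
    using assms by (auto simp: norm_divide intro!: frac_le)
qed (simp_all add: emeasure_lborel_Icc_eq)

context real_distribution
begin

text \<open>
  Away from the singularity the kernel \<open>sin (u x) / u\<close> is bounded by \<open>1 / \<epsilon>\<close>, uniformly in \<open>x\<close>, so
  Fubini's theorem applies to every probability law.
\<close>

lemma J_trunc_char:
  assumes "0 < e" "e \<le> A"
  shows "J_trunc (char M) t e A = 1 / of_real pi * (CLINT x|M. iexp (t * x) * of_real (Si (A * x) - Si (e * x)))"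
proof -
  interpret P: pair_sigma_finite lborel M ..
  let ?K = "\<lambda>u x. iexp (t * x) * of_real (2 * (sin (u * x) / u)) * \<i>"
  have kernel: "(iexp ((t + u) * x) - iexp ((t - u) * x)) / of_real u = ?K u x" for u x
  proof -
    have "iexp ((t + u) * x) - iexp ((t - u) * x) = iexp (t * x) * (iexp (u * x) - iexp (- (u * x)))"
      by (simp add: algebra_simps exp_add exp_diff exp_minus divide_inverse)
    also have "iexp (u * x) - iexp (- (u * x)) = 2 * \<i> * of_real (sin (u * x))"
      by (simp add: complex_eq_iff Re_exp Im_exp)
    finally show ?thesis by simp
  qed
  have char_diff: "(char M (t + u) - char M (t - u)) / of_real u = (CLINT x|M. ?K u x)" for u
    unfolding kernel[symmetric] integral_divide_zero char_def
    by (subst Bochner_Integration.integral_diff) (auto intro!: integrable_iexp)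
  have "J_trunc (char M) t e A = 1 / (2 * of_real pi * \<i>) *
      (CLINT u:{e..A}|lborel. (char M (t + u) - char M (t - u)) / of_real u)"
    using assms cmod_char_le_1
    by (intro J_trunc_eq_odd_part set_integrable_bounded_divide_Icc[where B = 1]) auto
  also have "(CLINT u:{e..A}|lborel. (char M (t + u) - char M (t - u)) / of_real u) =
      (CLINT u|lborel. CLINT x|M. indicator {e..A} u *\<^sub>R ?K u x)"
    by (simp only: set_lebesgue_integral_def char_diff integral_scaleR_right)
  also have "\<dots> = (CLINT x|M. CLINT u|lborel. indicator {e..A} u *\<^sub>R ?K u x)"
  proof (intro P.Fubini_integral[symmetric])
    show "integrable (lborel \<Otimes>\<^sub>M M) (\<lambda>(u, x). indicator {e..A} u *\<^sub>R ?K u x)"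
    proof (rule integrableI_bounded_set[where A = "{e..A} \<times> space M" and B = "2 / e"])
      show "emeasure (lborel \<Otimes>\<^sub>M M) ({e..A} \<times> space M) < \<infinity>"
        using assms by (subst emeasure_pair_measure_Times)
           (auto simp: ennreal_mult_less_top not_less top_unique)
      have "norm (?K u x) \<le> 2 / e" if "e \<le> u" for u x
        using that assms by (auto simp: norm_mult norm_divide intro!: frac_le)
      then show "AE z\<in>{e..A} \<times> space M in lborel \<Otimes>\<^sub>M M.
          norm (case z of (u, x) \<Rightarrow> indicator {e..A} u *\<^sub>R ?K u x) \<le> 2 / e"
        by auto
    qed (auto split: split_indicator split_indicator_asm)
  qed
  also have "\<dots> = (CLINT x|M. 2 * \<i> * (iexp (t * x) * of_real (Si (A * x) - Si (e * x))))"
  proof (intro Bochner_Integration.integral_cong refl)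
    fix x
    have "(CLINT u|lborel. indicator {e..A} u *\<^sub>R ?K u x) =
        (CLINT u|lborel. (2 * \<i> * iexp (t * x)) * of_real (indicator {e..A} u *\<^sub>R (sin (u * x) / u)))"
      by (intro Bochner_Integration.integral_cong refl) (simp split: split_indicator)
    also have "\<dots> = 2 * \<i> * iexp (t * x) * of_real (LBINT u:{e..A}. sin (u * x) / u)"
      by (simp only: integral_mult_right_zero integral_complex_of_real set_lebesgue_integral_def)
    finally show "(CLINT u|lborel. indicator {e..A} u *\<^sub>R ?K u x) =
        2 * \<i> * (iexp (t * x) * of_real (Si (A * x) - Si (e * x)))"
      using assms by (simp add: LBINT_sin_scale_divide_Icc)
  qed
  finally show ?thesis
    by simp
qed

section \<open>Removing the cut-offs\<close>

text \<open>
  The sine integral is bounded, which supplies the dominating constant. The scale \<open>h\<close> serves both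
  cut-offs: \<open>h n = n\<close> for the outer one and \<open>h n = 1 / n\<close> for the inner one.
\<close>

lemma tendsto_integral_iexp_Si:
  assumes "\<And>x. ((\<lambda>n. Si (h n * x)) \<longlongrightarrow> g x) (at_top :: real filter)"
    and [measurable]: "g \<in> borel_measurable borel"
  shows "((\<lambda>n. CLINT x|M. iexp (t * x) * of_real (Si (h n * x))) \<longlongrightarrow>
     (CLINT x|M. iexp (t * x) * of_real (g x))) at_top"
proof -
  from bounded_Si obtain B where "\<And>T. \<bar>Si T\<bar> \<le> B" by auto
  then show ?thesis
    by (intro integral_dominated_convergence_at_top[where w = "\<lambda>_. B"])
       (auto simp: norm_mult intro!: tendsto_intros assms)
qed

text \<open>
  By lemma \<open>J_trunc_char\<close> the truncated value is a difference \<open>G A - G e\<close> up to the factor \<open>1 / \<pi>\<close>,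
  so two one-variable limits of \<open>G\<close> give the limit along the product filter.
\<close>

lemma J_trunc_char_tendsto:
  "((\<lambda>(e, A). J_trunc (char M) t e A) \<longlongrightarrow> 1 / 2 * (CLINT x|M. iexp (t * x) * of_real (sgn x)))
     (at_right 0 \<times>\<^sub>F at_top)"
proof -
  define G where "G T = (CLINT x|M. iexp (t * x) * of_real (Si (T * x)))" for T
  from bounded_Si obtain B where B: "\<And>T. \<bar>Si T\<bar> \<le> B" by auto
  have int: "integrable M (\<lambda>x. iexp (t * x) * of_real (Si (T * x)))" for T
    using B by (intro integrable_const_bound[where B = B]) (auto simp: norm_mult)
  have top: "(G \<longlongrightarrow> pi / 2 * (CLINT x|M. iexp (t * x) * of_real (sgn x))) at_top"
    using tendsto_integral_iexp_Si[of "\<lambda>T. T", OF Si_scale_at_top, of t]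
    unfolding G_def[symmetric] by (simp add: mult.left_commute)
  have "((\<lambda>n. Si (inverse n * x)) \<longlongrightarrow> 0) at_top" for x
  proof -
    have "((\<lambda>n. Si (inverse n * x)) \<longlongrightarrow> Si (0 * x)) at_top"
      by (intro isCont_tendsto_compose[OF isCont_Si] tendsto_intros tendsto_inverse_0_at_top filterlim_ident)
    then show ?thesis by (simp add: Si_zero)
  qed
  then have zero: "(G \<longlongrightarrow> 0) (at_right 0)"
    unfolding filterlim_at_right_to_top G_def
    using tendsto_integral_iexp_Si[of inverse "\<lambda>_. 0" t] by simp
  have "((\<lambda>p. 1 / of_real pi * (G (snd p) - G (fst p))) \<longlongrightarrow>
      1 / of_real pi * (pi / 2 * (CLINT x|M. iexp (t * x) * of_real (sgn x)) - 0)) (at_right 0 \<times>\<^sub>F at_top)"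
    by (intro tendsto_intros filterlim_compose[OF top filterlim_snd]
        filterlim_compose[OF zero filterlim_fst])
  \<comment> \<open>The bound 1 merely separates the cut-offs: it makes \<open>e \<le> A\<close> hold eventually along the product filter.\<close>
  moreover have "\<forall>\<^sub>F p in at_right 0 \<times>\<^sub>F at_top.
      1 / of_real pi * (G (snd p) - G (fst p)) = (case p of (e, A) \<Rightarrow> J_trunc (char M) t e A)"
  proof -
    have "\<forall>\<^sub>F p in at_right (0 :: real) \<times>\<^sub>F (at_top :: real filter). (0 < fst p \<and> fst p < 1) \<and> 1 \<le> snd p"
      using eventually_at_right_real[of 0 "1 :: real"]
      by (intro eventually_prodI eventually_ge_at_top) simp
    then show ?thesis
    proof eventually_elim
      case (elim p)
      then show ?case
        using int by (simp add: split_beta J_trunc_char G_def right_diff_distrib)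
    qed
  qed
  ultimately show ?thesis
    by (simp add: tendsto_cong)
qed

end

section \<open>The positive part\<close>

theorem corollary2:
  fixes M :: "'a measure" and X :: "'a \<Rightarrow> real" and f :: "real \<Rightarrow> complex"
  assumes "prob_space M"
    and "X \<in> borel_measurable M"
    and "f = char (distr M borel X)"
  shows "\<forall>t. J_converges f t \<and>
    (CLINT \<omega>|M. iexp (t * max 0 (X \<omega>))) = 1 / 2 * (1 + f t) + J f t - J f 0"
proof
  fix t
  interpret prob_space M by fact
  have [measurable]: "X \<in> borel_measurable M" by fact
  interpret X: real_distribution "distr M borel X" by (rule real_distribution_distr) simp
  have lim: "((\<lambda>(e, A). J_trunc f s e A) \<longlongrightarrow> 1 / 2 * (CLINT \<omega>|M. iexp (s * X \<omega>) * of_real (sgn (X \<omega>))))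
      (at_right 0 \<times>\<^sub>F at_top)" for s
    using X.J_trunc_char_tendsto[of s] by (simp add: assms(3) integral_distr)
  have J: "J f s = 1 / 2 * (CLINT \<omega>|M. iexp (s * X \<omega>) * of_real (sgn (X \<omega>)))" for s
    unfolding J_def by (rule tendsto_Lim[OF _ lim]) (simp add: prod_filter_eq_bot)
  have int: "integrable M (\<lambda>\<omega>. iexp (t * X \<omega>))" by (intro integrable_iexp) auto
  have int_sgn: "integrable M (\<lambda>\<omega>. iexp (s * X \<omega>) * of_real (sgn (X \<omega>)))" for s
    by (intro integrable_const_bound[where B = 1]) (auto simp: norm_mult sgn_if)
  \<comment> \<open>The factor \<open>iexp (0 * X \<omega>)\<close>, equal to 1, puts the last term in the form of \<open>J f 0\<close>.\<close>
  have "(CLINT \<omega>|M. iexp (t * max 0 (X \<omega>))) =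
      (CLINT \<omega>|M. 1 / 2 * (1 + iexp (t * X \<omega>)) + 1 / 2 * (iexp (t * X \<omega>) * of_real (sgn (X \<omega>))) -
         1 / 2 * (iexp (0 * X \<omega>) * of_real (sgn (X \<omega>))))"
    by (intro Bochner_Integration.integral_cong) (auto simp: sgn_if max_def field_simps)
  also have "\<dots> = 1 / 2 * (1 + (CLINT \<omega>|M. iexp (t * X \<omega>))) + J f t - J f 0"
    unfolding J using int int_sgn[of t] int_sgn[of 0] by (simp add: prob_space)
  also have "(CLINT \<omega>|M. iexp (t * X \<omega>)) = f t"
    by (simp add: assms(3) char_def integral_distr)
  finally show "J_converges f t \<and>
      (CLINT \<omega>|M. iexp (t * max 0 (X \<omega>))) = 1 / 2 * (1 + f t) + J f t - J f 0"
    using lim[of t] by (auto simp: J_converges_def)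
qed

end
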